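(* Let $n$ be a positive integer, $x=\{x_1,\dots,x_n\}$ a set of $n$ variables, $a$ a complex number and $k$ a positive integer. Then $$\sum_{\lambda\subseteq(k^n)}q^{n(\lambda)}(a;q^{-1})_{\ell(\lambda)}(a;q^{-1})_{n-m_k(\lambda)}P_\lambda(x;q)$$ $$=\sum_{I\subseteq[n]}q^{k\binom{|I|}{2}}(a;q^{-1})_{|I|}(a;q^{-1})_{n-|I|}\prod_{i\in I}x_i^k\prod_{i\in I}\frac{1-ax_i^{-1}q^{1-n}}{1-x_i^{-1}q^{1-|I|}}\prod_{j\notin I}\frac{1-ax_j}{1-x_jq^{|I|}}\prod_{i\in I,\,j\notin I}\frac{x_i-qx_j}{x_i-x_j},$$ where the left sum is over partitions $\lambda$ with $\lambda_1\le k$ and $\ell(\lambda)\le n$, $[n]=\{1,\dots,n\}$ and $|I|$ is the cardinality of $I$.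
   Context: For a partition $\lambda$: $\ell(\lambda)$ is its number of nonzero parts, $m_i(\lambda)$ the number of parts equal to $i$ ($m_0(\lambda)=n-\ell(\lambda)$ when viewed with $n$ parts), and $n(\lambda)=\sum_{i\ge1}(i-1)\lambda_i$. $(a;q)_r=(1-a)(1-aq)\cdots(1-aq^{r-1})$, so $(a;q^{-1})_r=(1-a)(1-aq^{-1})\cdots(1-aq^{1-r})$. $P_\lambda(x;q)$ is the Hall-Littlewood polynomial in $n$ variables: for $\ell(\lambda)\le n$, $$P_\lambda(x;q)=\prod_{i\ge0}\frac{(1-q)^{m_i(\lambda)}}{(q;q)_{m_i(\lambda)}}\sum_{w\in S_n}w\Big(x_1^{\lambda_1}\cdots x_n^{\lambda_n}\prod_{i<j}\frac{x_i-qx_j}{x_i-x_j}\Big),$$ where $S_n$ acts by permuting the variables. *)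

theory Defs
  imports Complex_Main "HOL-Combinatorics.Permutations"
begin

(* A partition is a sequence lam 1 >= lam 2 >= ... of naturals that is eventually zero.
   Parts are indexed from 1; the unused value lam 0 is set to 0 so that every partition
   is represented by exactly one function. *)

definition is_partition :: "(nat \<Rightarrow> nat) \<Rightarrow> bool" where
  "is_partition lam \<longleftrightarrow>
     lam 0 = 0 \<and> (\<forall>i\<ge>1. lam (Suc i) \<le> lam i) \<and> finite {i. lam i \<noteq> 0}"

definition part_length :: "(nat \<Rightarrow> nat) \<Rightarrow> nat" where
  "part_length lam = card {i. 1 \<le> i \<and> lam i \<noteq> 0}"

(* The multiplicity of i in lam viewed with n parts, so that
   part_mult n lam 0 = n - part_length lam when part_length lam <= n. *)
definition part_mult :: "nat \<Rightarrow> (nat \<Rightarrow> nat) \<Rightarrow> nat \<Rightarrow> nat" where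
  "part_mult n lam i = card {j \<in> {1..n}. lam j = i}"

definition part_n :: "(nat \<Rightarrow> nat) \<Rightarrow> nat" where
  "part_n lam = (\<Sum>i = 1..part_length lam. (i - 1) * lam i)"

definition partitions_in_box :: "nat \<Rightarrow> nat \<Rightarrow> (nat \<Rightarrow> nat) set" where
  "partitions_in_box k n = {lam. is_partition lam \<and> lam 1 \<le> k \<and> part_length lam \<le> n}"

definition qpoch :: "'a::comm_ring_1 \<Rightarrow> 'a \<Rightarrow> nat \<Rightarrow> 'a" where
  "qpoch a q r = (\<Prod>j<r. 1 - a * q ^ j)"

(* The value at the point (x 1, ..., x n) of the Hall-Littlewood polynomial. The formula is
   meaningful for x injective on {1..n} and q ^ r not equal to 1 for 1 <= r <= n.
   The product over all i >= 0 stops at the largest part, since beyond it the multiplicities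
   vanish and the factors equal 1. *)
definition hall_littlewood_P ::
    "nat \<Rightarrow> (nat \<Rightarrow> nat) \<Rightarrow> (nat \<Rightarrow> 'a::field) \<Rightarrow> 'a \<Rightarrow> 'a" where
  "hall_littlewood_P n lam x q =
     (\<Prod>i = 0..lam 1. (1 - q) ^ part_mult n lam i / qpoch q q (part_mult n lam i)) *
     (\<Sum>w | w permutes {1..n}.
        (\<Prod>i = 1..n. x (w i) ^ lam i) *
        (\<Prod>(i, j) \<in> {(i, j). i \<in> {1..n} \<and> j \<in> {1..n} \<and> i < j}.
           (x (w i) - q * x (w j)) / (x (w i) - x (w j))))"

lemma partition_antimono:
  assumes "is_partition lam" "1 \<le> i" "i \<le> j"
  shows "lam j \<le> lam i"
  using assms(3)
proof (induction j rule: dec_induct)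
  case (step m)
  then show ?case
    using assms(1,2) unfolding is_partition_def by (meson le_trans)
qed simp

lemma partition_zero_beyond_length:
  assumes lam: "is_partition lam" and "part_length lam < i"
  shows "lam i = 0"
proof (rule ccontr)
  assume nz: "lam i \<noteq> 0"
  have "{1..i} \<subseteq> {j. 1 \<le> j \<and> lam j \<noteq> 0}"
    using partition_antimono[OF lam] nz by fastforce
  moreover have "finite {j. 1 \<le> j \<and> lam j \<noteq> 0}"
    using lam unfolding is_partition_def by auto
  ultimately have "card {1..i} \<le> part_length lam"
    unfolding part_length_def by (rule card_mono[rotated])
  then show False using assms(2) by simp
qed

lemma finite_partitions_in_box: "finite (partitions_in_box k n)"
proof (rule finite_subset)
  let ?F = "{f. \<forall>i. (i \<in> {1..n} \<longrightarrow> f i \<in> {0..k}) \<and> (i \<notin> {1..n} \<longrightarrow> f i = (0::nat))}"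
  show "finite ?F"
    by (rule finite_set_of_finite_funs) auto
  show "partitions_in_box k n \<subseteq> ?F"
  proof
    fix lam assume "lam \<in> partitions_in_box k n"
    then have p: "is_partition lam" "lam 1 \<le> k" "part_length lam \<le> n"
      unfolding partitions_in_box_def by auto
    have "lam i \<le> k" if "1 \<le> i" for i
      using partition_antimono[OF p(1) order_refl that] p(2) by simp
    moreover have "lam i = 0" if "i \<notin> {1..n}" for i
    proof (cases "i = 0")
      case True
      then show ?thesis using p(1) unfolding is_partition_def by simp
    next
      case False
      then have "n < i" using that by simp
      then show ?thesis using partition_zero_beyond_length[OF p(1)] p(3) by simp
    qed
    ultimately show "lam \<in> ?F" by simp
  qed
qed

end

(* A box partition of width k with at most n parts is a chain of row sets: removing the first
   column turns P_lam(x_S; q) into a sum over the subsets I of S carrying the nonzero parts, with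
   factor x^I prod_{i in I, j in S - I} (x_i - q x_j) / (x_i - x_j). So the left-hand side is
   obtained by applying k times a triangular operator on functions of subsets whose diagonal
   entries are q^binom(|I|, 2) x^I. Its eigenvectors are explicit products, and the identity
   results from expanding the initial function S |-> (a; 1/q)_{n - |S|} in them. The eigenvector
   property and the expansion are two rational identities, each proved by interpolation in an
   auxiliary parameter. *)

theory Submission
  imports Defs "HOL-Computational_Algebra.Polynomial" "HOL-Combinatorics.Multiset_Permutations"
begin

section \<open>Subset sums of cross products\<close>

text \<open>The two Pochhammer factors enter at opposite ends of the chain. The length of a
  partition is the size of its first column, so the factor at the length is felt only in the
  outermost step. The multiplicity of the largest allowed part is unchanged when a column is removed
  and the bound drops by one, so the other factor survives to the empty box and becomes the initial
  function. The outermost operator thus carries an extra weight, and \<open>sum_qpoch_eig\<close>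
  keeps \<open>a\<close> free: \<open>a = 0\<close> gives the eigenvectors, general \<open>a\<close>
  the numerators \<open>1 - a * x j\<close>.

  The initial function involves the total number \<open>n\<close> of variables, while its expansion
  is needed on every subset \<open>S\<close>. With \<open>e = a * inverse q ^ (n - 1)\<close> it
  becomes the product of \<open>1 - e * q ^ j\<close> for \<open>j\<close> from
  \<open>card S\<close> to \<open>n - 1\<close>. Common factors then split off, and what is left is
  an identity within \<open>S\<close> in a free parameter \<open>e\<close>, suited to interpolation.
  This is also the origin of the power of \<open>q\<close> with exponent \<open>1 - n\<close> in the
  result.\<close>

definition cross :: "'a::field \<Rightarrow> (nat \<Rightarrow> 'a) \<Rightarrow> nat set \<Rightarrow> nat set \<Rightarrow> 'a" where
  "cross q x I J = (\<Prod>i\<in>I. \<Prod>j\<in>J. (x i - q * x j) / (x i - x j))"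

lemma cross_empty [simp]: "cross q x {} J = 1" "cross q x I {} = 1"
  by (simp_all add: cross_def)

lemma cross_Un_left:
  "finite I \<Longrightarrow> finite I' \<Longrightarrow> I \<inter> I' = {} \<Longrightarrow>
    cross q x (I \<union> I') J = cross q x I J * cross q x I' J"
  by (simp add: cross_def prod.union_disjoint)

lemma cross_Un_right:
  "finite J \<Longrightarrow> finite J' \<Longrightarrow> J \<inter> J' = {} \<Longrightarrow>
    cross q x I (J \<union> J') = cross q x I J * cross q x I J'"
  by (simp add: cross_def prod.union_disjoint prod.distrib)

text \<open>The factors are homogeneous of degree 0. Rescaling by \<open>q\<close> feeds the
  induction of the binomial sum, rescaling by \<open>q ^ card J\<close> the eigenvector
  computation.\<close>

lemma cross_scale:
  assumes "t \<noteq> 0"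
  shows "cross q (\<lambda>i. t * x i) I J = cross q x I J"
proof -
  have "(t * x i - q * (t * x j)) / (t * x i - t * x j) = (x i - q * x j) / (x i - x j)" for i j
  proof -
    have "t * x i - q * (t * x j) = t * (x i - q * x j)" "t * x i - t * x j = t * (x i - x j)"
      by (simp_all add: algebra_simps)
    then show ?thesis using assms by simp
  qed
  then show ?thesis by (simp add: cross_def)
qed

lemma sum_Pow_superset:
  assumes "J \<subseteq> T"
  shows "(\<Sum>I | I \<subseteq> T \<and> J \<subseteq> I. f I) = (\<Sum>K\<in>Pow (T - J). f (J \<union> K))"
  using assms
  by (intro sum.reindex_bij_witness[where i = "\<lambda>K. J \<union> K" and j = "\<lambda>I. I - J"])
    (auto simp: Un_absorb1)

text \<open>Interchange over chains of subsets, with the larger set written as a disjoint union. It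
  moves the eigenvector index \<open>J\<close> outside the operator.\<close>

lemma sum_Pow_Pow:
  assumes "finite T"
  shows "(\<Sum>I\<in>Pow T. \<Sum>J\<in>Pow I. f I J) = (\<Sum>J\<in>Pow T. \<Sum>K\<in>Pow (T - J). f (J \<union> K) J)"
proof -
  have "(\<Sum>I\<in>Pow T. \<Sum>J\<in>Pow I. f I J) = (\<Sum>I\<in>Pow T. \<Sum>J | J \<in> Pow T \<and> J \<subseteq> I. f I J)"
    by (intro sum.cong refl) auto
  also have "\<dots> = (\<Sum>J\<in>Pow T. \<Sum>I | I \<in> Pow T \<and> J \<subseteq> I. f I J)"
    using assms by (intro sum.swap_restrict) auto
  also have "\<dots> = (\<Sum>J\<in>Pow T. \<Sum>K\<in>Pow (T - J). f (J \<union> K) J)"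
  proof (rule sum.cong[OF refl])
    fix J assume "J \<in> Pow T"
    then show "(\<Sum>I | I \<in> Pow T \<and> J \<subseteq> I. f I J) = (\<Sum>K\<in>Pow (T - J). f (J \<union> K) J)"
      using sum_Pow_superset[of J T "\<lambda>I. f I J"] by simp
  qed
  finally show ?thesis .
qed

lemma degree_prod_monic_linear:
  fixes f :: "'b \<Rightarrow> 'a::field"
  shows "degree (\<Prod>j\<in>A. [:f j, 1:]) = card A" "coeff (\<Prod>j\<in>A. [:f j, 1:]) (card A) = 1"
proof -
  show *: "degree (\<Prod>j\<in>A. [:f j, 1:]) = card A"
    by (subst degree_prod_eq_sum_degree) auto
  have "lead_coeff (\<Prod>j\<in>A. [:f j, 1:]) = 1"
    by (subst lead_coeff_prod) auto
  then show "coeff (\<Prod>j\<in>A. [:f j, 1:]) (card A) = 1"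
    using * by simp
qed

lemma degree_prod_linear_le:
  fixes f g :: "'b \<Rightarrow> 'a::field"
  shows "degree (\<Prod>j\<in>A. [:f j, g j:]) \<le> card A"
proof (cases "finite A")
  case True
  have "degree (\<Prod>j\<in>A. [:f j, g j:]) \<le> (\<Sum>j\<in>A. degree [:f j, g j:])"
    using degree_prod_sum_le[OF True, of "\<lambda>j. [:f j, g j:]"] by (simp add: o_def)
  also have "\<dots> \<le> (\<Sum>j\<in>A. 1)" by (intro sum_mono) auto
  finally show ?thesis by simp
qed simp

text \<open>Both sides are monic polynomials of degree \<open>card S\<close> in \<open>c\<close>. At \<open>c = y p\<close> only the sets containing
  \<open>p\<close> contribute, and what is left is the same identity for \<open>S - {p}\<close>, \<open>q y\<close> and \<open>b / q\<close>.\<close>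

lemma sum_cross_binomial:
  fixes q :: "'a::field"
  assumes "finite S" "inj_on y S" "q \<noteq> 0"
  shows "(\<Sum>K\<in>Pow S. (\<Prod>j<card K. q ^ j - b) * (\<Prod>i\<in>K. y i) * cross q y K (S - K) *
      (\<Prod>j\<in>S - K. c - y j)) = (\<Prod>j\<in>S. c - b * y j)"
  using assms(1,2)
proof (induction "card S" arbitrary: S b c y)
  case 0
  then show ?case by simp
next
  case (Suc s)
  define A where "A K = (\<Prod>j<card K. q ^ j - b) * (\<Prod>i\<in>K. y i) * cross q y K (S - K)" for K
  define P where "P = (\<Sum>K\<in>Pow S. smult (A K) (\<Prod>j\<in>S - K. [:- y j, 1:]))"
  define Q where "Q = (\<Prod>j\<in>S. [:- (b * y j), 1:])"
  have P: "poly P z = (\<Sum>K\<in>Pow S. A K * (\<Prod>j\<in>S - K. z - y j))" for z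
    by (simp add: P_def poly_sum poly_prod)
  have Q: "poly Q z = (\<Prod>j\<in>S. z - b * y j)" for z
    by (simp add: Q_def poly_prod)
  \<comment> \<open>Equal leading coefficients save one node, so the \<open>card S\<close> values of
    \<open>y\<close> suffice. In \<open>P\<close> only \<open>K = {}\<close> reaches degree
    \<open>card S\<close>.\<close>
  have "P = Q"
  proof (rule poly_eqI_degree_lead_coeff[where n = "card S" and A = "y ` S"])
    have "coeff P (card S) = (\<Sum>K\<in>Pow S. if K = {} then 1 else 0)"
      unfolding P_def coeff_sum
    proof (rule sum.cong[OF refl])
      fix K assume K: "K \<in> Pow S"
      show "coeff (smult (A K) (\<Prod>j\<in>S - K. [:- y j, 1:])) (card S) = (if K = {} then 1 else 0)"
      proof (cases "K = {}")
        case True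
        then show ?thesis by (simp add: A_def degree_prod_monic_linear(2))
      next
        case False
        then have "card (S - K) < card S"
          using K Suc.prems by (intro psubset_card_mono) auto
        then show ?thesis
          using False by (simp add: coeff_eq_0 degree_prod_monic_linear(1))
      qed
    qed
    also have "\<dots> = 1" using Suc.prems by simp
    finally show "coeff P (card S) = coeff Q (card S)"
      by (simp add: Q_def degree_prod_monic_linear)
    show "card S \<le> card (y ` S)" using Suc.prems by (simp add: card_image)
    show "degree Q \<le> card S" by (simp add: Q_def degree_prod_monic_linear)
    show "degree P \<le> card S"
      unfolding P_def using Suc.prems
      by (intro degree_sum_le order.trans[OF degree_smult_le])
        (auto simp: degree_prod_monic_linear intro: card_mono)
    fix z assume "z \<in> y ` S"
    then obtain p where p: "p \<in> S" "z = y p" by auto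
    define T where "T = S - {p}"
    have T: "finite T" "card T = s" "inj_on y T" "p \<notin> T" "S = insert p T"
      using Suc.prems Suc.hyps(2) p by (auto simp: T_def card_Diff_subset inj_on_diff)
    have "poly P z = (\<Sum>K | K \<subseteq> S \<and> {p} \<subseteq> K. A K * (\<Prod>j\<in>S - K. z - y j))"
      unfolding P
    proof (rule sum.mono_neutral_right)
      show "\<forall>K\<in>Pow S - {K. K \<subseteq> S \<and> {p} \<subseteq> K}. A K * (\<Prod>j\<in>S - K. z - y j) = 0"
      proof
        fix K assume "K \<in> Pow S - {K. K \<subseteq> S \<and> {p} \<subseteq> K}"
        then have "p \<in> S - K" using p by auto
        then show "A K * (\<Prod>j\<in>S - K. z - y j) = 0"
          using p Suc.prems(1) by (auto simp: prod_zero_iff)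
      qed
    qed (use Suc.prems in auto)
    also have "\<dots> = (\<Sum>K\<in>Pow T. A ({p} \<union> K) * (\<Prod>j\<in>S - ({p} \<union> K). z - y j))"
      unfolding T_def by (rule sum_Pow_superset) (use p in auto)
    also have "\<dots> = (\<Sum>K\<in>Pow T. (1 - b) * z *
        ((\<Prod>j<card K. q ^ j - b / q) * (\<Prod>i\<in>K. q * y i) * cross q (\<lambda>i. q * y i) K (T - K) *
        (\<Prod>j\<in>T - K. z - q * y j)))"
    proof (rule sum.cong[OF refl])
      fix K assume "K \<in> Pow T"
      then have K: "K \<subseteq> T" "finite K" "p \<notin> K" using T finite_subset by auto
      have D: "S - ({p} \<union> K) = T - K" using T by auto
      \<comment> \<open>The factor at \<open>j = 0\<close> is \<open>1 - b\<close>. Each later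
        factor yields one \<open>q\<close>, which turns \<open>b\<close> into \<open>b / q\<close>;
        these powers of \<open>q\<close> are absorbed by rescaling \<open>y\<close>.\<close>
      have 1: "(\<Prod>j<card ({p} \<union> K). q ^ j - b) = (1 - b) * (q ^ card K * (\<Prod>j<card K. q ^ j - b / q))"
      proof -
        have "(\<Prod>j<card K. q ^ Suc j - b) = (\<Prod>j<card K. q * (q ^ j - b / q))"
          using assms(3) by (simp add: algebra_simps)
        then show ?thesis
          using K by (simp add: prod.lessThan_Suc_shift prod.distrib del: power_Suc prod.lessThan_Suc)
      qed
      \<comment> \<open>As \<open>z = y p\<close>, the denominators of the cross factors at
        \<open>p\<close> cancel the factors \<open>z - y j\<close>.\<close>
      have 2: "cross q y {p} (T - K) * (\<Prod>j\<in>T - K. z - y j) = (\<Prod>j\<in>T - K. z - q * y j)"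
      proof -
        have "(y p - q * y j) / (y p - y j) * (z - y j) = z - q * y j" if "j \<in> T - K" for j
        proof -
          have "y p \<noteq> y j" using that T Suc.prems(2) by (auto simp: inj_on_def)
          then show ?thesis using p by simp
        qed
        then show ?thesis unfolding cross_def by (simp flip: prod.distrib)
      qed
      have 3: "cross q y ({p} \<union> K) (T - K) = cross q y {p} (T - K) * cross q y K (T - K)"
        using K by (intro cross_Un_left) auto
      have "A ({p} \<union> K) * (\<Prod>j\<in>S - ({p} \<union> K). z - y j) =
        ((\<Prod>j<card ({p} \<union> K). q ^ j - b)) * z * (\<Prod>i\<in>K. y i) * cross q y K (T - K) *
        (cross q y {p} (T - K) * (\<Prod>j\<in>T - K. z - y j))"
        unfolding A_def D 3 using K p by (simp add: mult_ac)
      also have "\<dots> = (1 - b) * z *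
        ((\<Prod>j<card K. q ^ j - b / q) * (q ^ card K * (\<Prod>i\<in>K. y i)) * cross q y K (T - K) *
        (\<Prod>j\<in>T - K. z - q * y j))"
        unfolding 1 2 by (simp add: mult_ac)
      finally show "A ({p} \<union> K) * (\<Prod>j\<in>S - ({p} \<union> K). z - y j) = (1 - b) * z *
        ((\<Prod>j<card K. q ^ j - b / q) * (\<Prod>i\<in>K. q * y i) * cross q (\<lambda>i. q * y i) K (T - K) *
        (\<Prod>j\<in>T - K. z - q * y j))"
        by (simp add: prod.distrib cross_scale assms(3))
    qed
    also have "\<dots> = (1 - b) * z * (\<Prod>j\<in>T. z - b / q * (q * y j))"
      unfolding sum_distrib_left[symmetric]
      using T assms(3) by (subst Suc.hyps(1)) (auto simp: inj_on_def)
    also have "\<dots> = (\<Prod>j\<in>S. z - b * y j)"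
      using T p assms(3) by (simp add: algebra_simps)
    finally show "poly P z = poly Q z" by (simp add: Q)
  qed
  then have "poly P c = poly Q c" by simp
  then show ?case by (simp add: P Q A_def)
qed

text \<open>This is \<open>sum_cross_binomial\<close> at \<open>b = q\<close>, \<open>c = 0\<close>:
  the factor \<open>q ^ 1 - q\<close> kills every \<open>K\<close> with at least two elements, and
  the empty set and the singletons remain.\<close>

lemma sum_cross_singleton:
  fixes q :: "'a::field"
  assumes "finite S" "inj_on y S" "q \<noteq> 0" "q \<noteq> 1" "\<forall>i\<in>S. y i \<noteq> 0"
  shows "(\<Sum>p\<in>S. cross q y {p} (S - {p})) = (1 - q ^ card S) / (1 - q)"
proof -
  let ?f = "\<lambda>K. (\<Prod>j<card K. q ^ j - q) * (\<Prod>i\<in>K. y i) * cross q y K (S - K) * (\<Prod>j\<in>S - K. 0 - y j)"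
  define Y where "Y = (\<Prod>j\<in>S. - y j)"
  have Y0: "Y \<noteq> 0" using assms by (simp add: Y_def)
  have "q ^ card S * Y = (\<Prod>j\<in>S. 0 - q * y j)"
    by (simp add: Y_def flip: prod_constant prod.distrib)
  also have "\<dots> = sum ?f (Pow S)"
    using sum_cross_binomial[OF assms(1-3), of q 0] by simp
  also have "\<dots> = sum ?f (insert {} ((\<lambda>p. {p}) ` S))"
  proof (rule sum.mono_neutral_right)
    show "\<forall>K\<in>Pow S - insert {} ((\<lambda>p. {p}) ` S). ?f K = 0"
    proof
      fix K assume K: "K \<in> Pow S - insert {} ((\<lambda>p. {p}) ` S)"
      then have "finite K" using assms finite_subset by auto
      have "card K \<noteq> 0" using K \<open>finite K\<close> by auto
      moreover have "card K \<noteq> 1" using K by (auto simp: card_1_singleton_iff)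
      ultimately have "1 < card K" by linarith
      then have "(\<Prod>j<card K. q ^ j - q) = 0" by (intro prod_zero) (auto intro!: bexI[of _ 1])
      then show "?f K = 0" by simp
    qed
  qed (use assms in auto)
  also have "\<dots> = Y + (\<Sum>p\<in>S. ?f {p})"
    using assms by (subst sum.insert) (auto simp: sum.reindex Y_def)
  also have "(\<Sum>p\<in>S. ?f {p}) = (\<Sum>p\<in>S. - (1 - q) * Y * cross q y {p} (S - {p}))"
    using assms by (intro sum.cong refl) (simp add: Y_def prod.remove algebra_simps)
  also have "\<dots> = - (1 - q) * Y * (\<Sum>p\<in>S. cross q y {p} (S - {p}))"
    by (simp only: sum_distrib_left)
  finally have "(1 - q) * (\<Sum>p\<in>S. cross q y {p} (S - {p})) * Y = (1 - q ^ card S) * Y"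
    by (simp add: algebra_simps)
  then have "(1 - q) * (\<Sum>p\<in>S. cross q y {p} (S - {p})) = 1 - q ^ card S"
    using Y0 by (simp only: mult_right_cancel simp_thms)
  then show ?thesis using assms(4) by (simp add: eq_divide_eq mult.commute)
qed

text \<open>The sum is a polynomial of degree at most \<open>card S\<close> in \<open>e\<close>. At \<open>e = inverse q ^ (card S - 1)\<close> only
  \<open>J = S\<close> survives; at \<open>e = x p\<close> only the \<open>J\<close> avoiding \<open>p\<close> do, and they form the same sum for \<open>S - {p}\<close>
  and \<open>q e\<close>. The exponent \<open>card J - 1\<close> truncates only for \<open>J = {}\<close>, where its product is empty.\<close>

lemma sum_cross_partition_of_unity:
  fixes q :: "'a::field"
  assumes "finite S" "inj_on x S" "q \<noteq> 0" "\<forall>i\<in>S. \<forall>r<card S. x i * q ^ r \<noteq> 1"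
  shows "(\<Sum>J\<in>Pow S. (\<Prod>j=card J..<card S. 1 - e * q ^ j) *
      (\<Prod>i\<in>J. (x i - e) / (x i - inverse q ^ (card J - 1))) *
      (\<Prod>i\<in>S - J. 1 / (1 - x i * q ^ card J)) * cross q x J (S - J)) = 1"
  using assms(1,2,4)
proof (induction "card S" arbitrary: S e)
  case 0
  then show ?case by simp
next
  case (Suc s)
  define A where "A J = (\<Prod>i\<in>J. 1 / (x i - inverse q ^ (card J - 1))) *
    (\<Prod>i\<in>S - J. 1 / (1 - x i * q ^ card J)) * cross q x J (S - J)" for J
  define P where "P = (\<Sum>J\<in>Pow S. smult (A J)
    ((\<Prod>j=card J..<card S. [:1, - (q ^ j):]) * (\<Prod>i\<in>J. [:x i, - 1:])))"
  have P: "poly P z = (\<Sum>J\<in>Pow S. A J * ((\<Prod>j=card J..<card S. 1 - z * q ^ j) * (\<Prod>i\<in>J. x i - z)))" for z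
    by (simp add: P_def poly_sum poly_prod)
  \<comment> \<open>No leading coefficient is available here, so one node beyond the values of
    \<open>x\<close> is used. The hypothesis at \<open>r = s\<close> keeps it distinct from
    them.\<close>
  have "P = 1"
  proof (rule poly_eqI_degree[where A = "insert (inverse q ^ s) (x ` S)"])
    have ni: "inverse q ^ s \<notin> x ` S"
    proof
      assume "inverse q ^ s \<in> x ` S"
      then obtain p where "p \<in> S" "x p = inverse q ^ s" by auto
      then have "x p * q ^ s = 1" using assms(3) by (simp flip: power_mult_distrib)
      then show False using Suc.prems(3) Suc.hyps(2) \<open>p \<in> S\<close> by auto
    qed
    then have c: "card (insert (inverse q ^ s) (x ` S)) = Suc (card S)"
      using Suc.prems by (simp add: card_image)
    show "degree 1 < card (insert (inverse q ^ s) (x ` S))" using c by simp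
    have "degree P \<le> card S"
      unfolding P_def
    proof (intro degree_sum_le order.trans[OF degree_smult_le])
      fix J assume "J \<in> Pow S"
      then have "card J \<le> card S" using Suc.prems by (auto intro: card_mono)
      then show "degree ((\<Prod>j=card J..<card S. [:1, - (q ^ j):]) * (\<Prod>i\<in>J. [:x i, - 1:])) \<le> card S"
        using degree_prod_linear_le[of "\<lambda>_. 1" "\<lambda>j. - (q ^ j)" "{card J..<card S}"]
          degree_prod_linear_le[of x "\<lambda>_. -1" J]
        by (intro order.trans[OF degree_mult_le]) auto
    qed (use Suc.prems in auto)
    then show "degree P < card (insert (inverse q ^ s) (x ` S))" using c by simp
    fix z assume "z \<in> insert (inverse q ^ s) (x ` S)"
    then consider "z = inverse q ^ s" | p where "p \<in> S" "z = x p" by auto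
    then show "poly P z = poly 1 z"
    proof cases
      case 1
      have zs: "z * q ^ s = 1" using 1 assms(3) by (simp flip: power_mult_distrib)
      have "poly P z = (\<Sum>J\<in>{S}. A J * ((\<Prod>j=card J..<card S. 1 - z * q ^ j) * (\<Prod>i\<in>J. x i - z)))"
        unfolding P
      proof (rule sum.mono_neutral_right)
        show "\<forall>J\<in>Pow S - {S}. A J * ((\<Prod>j=card J..<card S. 1 - z * q ^ j) * (\<Prod>i\<in>J. x i - z)) = 0"
        proof
          fix J assume J: "J \<in> Pow S - {S}"
          then have "card J < card S" using Suc.prems by (auto intro: psubset_card_mono)
          then have "s \<in> {card J..<card S}" using Suc.hyps(2) by auto
          then have "(\<Prod>j=card J..<card S. 1 - z * q ^ j) = 0"
            using zs by (intro prod_zero) (auto intro!: bexI[of _ s])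
          then show "A J * ((\<Prod>j=card J..<card S. 1 - z * q ^ j) * (\<Prod>i\<in>J. x i - z)) = 0" by simp
        qed
      qed (use Suc.prems in auto)
      \<comment> \<open>For \<open>J = S\<close> the denominator constant
        \<open>inverse q ^ (card J - 1)\<close> is the node \<open>z\<close> itself.\<close>
      also have "\<dots> = (\<Prod>i\<in>S. 1 / (x i - z) * (x i - z))"
        using Suc.hyps(2)[symmetric] 1 unfolding prod.distrib by (simp add: A_def)
      also have "\<dots> = (\<Prod>i\<in>S. 1)" using ni 1 by (intro prod.cong refl) (auto simp: image_iff)
      finally show ?thesis by simp
    next
      case p: 2
      define T where "T = S - {p}"
      have T: "finite T" "card T = s" "inj_on x T" "p \<notin> T" "S = insert p T"
        using Suc.prems Suc.hyps(2) p by (auto simp: T_def card_Diff_subset inj_on_diff)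
      have cS: "card S = Suc s" using Suc.hyps(2) by simp
      have "poly P z = (\<Sum>J\<in>Pow T. A J * ((\<Prod>j=card J..<card S. 1 - z * q ^ j) * (\<Prod>i\<in>J. x i - z)))"
        unfolding P
      proof (rule sum.mono_neutral_right)
        show "\<forall>J\<in>Pow S - Pow T. A J * ((\<Prod>j=card J..<card S. 1 - z * q ^ j) * (\<Prod>i\<in>J. x i - z)) = 0"
        proof
          fix J assume "J \<in> Pow S - Pow T"
          then have "p \<in> J" "finite J" using T Suc.prems(1) finite_subset by auto
          then show "A J * ((\<Prod>j=card J..<card S. 1 - z * q ^ j) * (\<Prod>i\<in>J. x i - z)) = 0"
            using p by (auto simp: prod_zero_iff)
        qed
      qed (use Suc.prems T in auto)
      also have "\<dots> = (\<Sum>J\<in>Pow T. (\<Prod>j=card J..<card T. 1 - (q * z) * q ^ j) *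
        (\<Prod>i\<in>J. (x i - q * z) / (x i - inverse q ^ (card J - 1))) *
        (\<Prod>i\<in>T - J. 1 / (1 - x i * q ^ card J)) * cross q x J (T - J))"
      proof (rule sum.cong[OF refl])
        fix J assume "J \<in> Pow T"
        then have J: "J \<subseteq> T" "finite J" "p \<notin> J" "card J \<le> s" using T finite_subset card_mono[of T J] by auto
        have D: "S - J = {p} \<union> (T - J)" using T J by auto
        have nz: "1 - z * q ^ card J \<noteq> 0"
          using J Suc.prems(3) p cS by auto
        \<comment> \<open>The first factor is split off because it cancels the denominator that
          \<open>p\<close>, lying outside \<open>J\<close>, contributes in fact 4. The shift of the
          remaining factors turns \<open>z\<close> into \<open>q * z\<close>.\<close>
        have 1: "(\<Prod>j=card J..<card S. 1 - z * q ^ j) =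
          (1 - z * q ^ card J) * (\<Prod>j=card J..<card T. 1 - (q * z) * q ^ j)"
        proof -
          have "(\<Prod>j=card J..<Suc s. 1 - z * q ^ j) =
            (1 - z * q ^ card J) * (\<Prod>j=Suc (card J)..<Suc s. 1 - z * q ^ j)"
            using J by (intro prod.atLeast_Suc_lessThan) simp
          then show ?thesis using cS T by (simp add: prod.shift_bounds_Suc_ivl mult_ac del: prod.op_ivl_Suc)
        qed
        have 2: "cross q x J {p} * (\<Prod>i\<in>J. x i - z) = (\<Prod>i\<in>J. x i - q * z)"
        proof -
          have "(x i - q * x p) / (x i - x p) * (x i - z) = x i - q * z" if "i \<in> J" for i
          proof -
            have "x i \<noteq> x p" using that T J Suc.prems(2) by (auto simp: inj_on_def)
            then show ?thesis using p by simp
          qed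
          then show ?thesis unfolding cross_def by (simp flip: prod.distrib)
        qed
        have 3: "cross q x J (S - J) = cross q x J {p} * cross q x J (T - J)"
          unfolding D using T J by (intro cross_Un_right) auto
        have 4: "(\<Prod>i\<in>S - J. 1 / (1 - x i * q ^ card J)) =
            1 / (1 - z * q ^ card J) * (\<Prod>i\<in>T - J. 1 / (1 - x i * q ^ card J))"
          unfolding D using T p by (subst prod.union_disjoint) auto
        have "A J * ((\<Prod>j=card J..<card S. 1 - z * q ^ j) * (\<Prod>i\<in>J. x i - z)) =
          (\<Prod>j=card J..<card T. 1 - (q * z) * q ^ j) *
          ((\<Prod>i\<in>J. 1 / (x i - inverse q ^ (card J - 1))) * (cross q x J {p} * (\<Prod>i\<in>J. x i - z))) *
          (\<Prod>i\<in>T - J. 1 / (1 - x i * q ^ card J)) * cross q x J (T - J)"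
          unfolding A_def 1 3 4 using nz by (simp add: mult_ac)
        then show "A J * ((\<Prod>j=card J..<card S. 1 - z * q ^ j) * (\<Prod>i\<in>J. x i - z)) =
          (\<Prod>j=card J..<card T. 1 - (q * z) * q ^ j) *
          (\<Prod>i\<in>J. (x i - q * z) / (x i - inverse q ^ (card J - 1))) *
          (\<Prod>i\<in>T - J. 1 / (1 - x i * q ^ card J)) * cross q x J (T - J)"
          unfolding 2 by (simp flip: prod.distrib)
      qed
      also have "\<dots> = 1"
        using T Suc.prems(3) cS by (intro Suc.hyps(1)) auto
      finally show ?thesis by simp
    qed
  qed
  then have "poly P e = 1" by simp
  also have "poly P e = (\<Sum>J\<in>Pow S. (\<Prod>j=card J..<card S. 1 - e * q ^ j) *
      (\<Prod>i\<in>J. (x i - e) / (x i - inverse q ^ (card J - 1))) *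
      (\<Prod>i\<in>S - J. 1 / (1 - x i * q ^ card J)) * cross q x J (S - J))"
    unfolding P A_def
    by (intro sum.cong refl) (simp add: mult_ac prod_dividef)
  finally show ?case .
qed

section \<open>Removing the first column of a partition\<close>

text \<open>\<open>hl_sum q x S ls\<close> is the symmetrization in the definition of the Hall-Littlewood polynomial with
  variables indexed by \<open>S\<close> and exponents \<open>ls\<close>, organized by the variable that comes first.\<close>

fun hl_sum :: "'a::field \<Rightarrow> (nat \<Rightarrow> 'a) \<Rightarrow> nat set \<Rightarrow> nat list \<Rightarrow> 'a" where
  "hl_sum q x S [] = 1"
| "hl_sum q x S (l # ls) = (\<Sum>p\<in>S. x p ^ l * cross q x {p} (S - {p}) * hl_sum q x (S - {p}) ls)"

text \<open>Once the set \<open>I\<close> filling the first \<open>length ls\<close> positions is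
  fixed, the factors between \<open>I\<close> and \<open>S - I\<close> do not depend on the
  orderings within the two blocks, so the sum factors.\<close>

lemma hl_sum_append:
  assumes "finite S"
  shows "hl_sum q x S (ls @ ms) = (\<Sum>I | I \<subseteq> S \<and> card I = length ls.
    hl_sum q x I ls * cross q x I (S - I) * hl_sum q x (S - I) ms)"
  using assms
proof (induction ls arbitrary: S)
  case Nil
  have "{I. I \<subseteq> S \<and> card I = length []} = {{}}"
    using Nil by (auto simp: card_eq_0_iff dest: finite_subset)
  then show ?case by simp
next
  case (Cons l ls)
  let ?f = "\<lambda>p I. x p ^ l * cross q x {p} (S - {p}) *
    (hl_sum q x I ls * cross q x I (S - {p} - I) * hl_sum q x (S - {p} - I) ms)"
  let ?g = "\<lambda>I p. x p ^ l * cross q x {p} (I - {p}) * hl_sum q x (I - {p}) ls *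
    cross q x I (S - I) * hl_sum q x (S - I) ms"
  \<comment> \<open>\<open>?f\<close> chooses the first variable before the rest of the block,
    \<open>?g\<close> chooses the whole block before its first variable.\<close>
  have eq: "?g (insert p I) p = ?f p I" if "p \<in> S" "I \<subseteq> S - {p}" for p I
  proof -
    have fin: "finite I" using that Cons.prems finite_subset by auto
    have "p \<notin> I" using that by auto
    have "cross q x {p} (S - {p}) = cross q x {p} (I \<union> (S - {p} - I))"
      using that by (simp add: Un_absorb1)
    also have "\<dots> = cross q x {p} I * cross q x {p} (S - {p} - I)"
      using fin Cons.prems by (intro cross_Un_right) auto
    finally have 1: "cross q x {p} (S - {p}) = cross q x {p} I * cross q x {p} (S - {p} - I)" .
    have "cross q x ({p} \<union> I) (S - {p} - I) = cross q x {p} (S - {p} - I) * cross q x I (S - {p} - I)"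
      using fin \<open>p \<notin> I\<close> by (intro cross_Un_left) auto
    moreover have "S - insert p I = S - {p} - I" by auto
    ultimately show ?thesis using \<open>p \<notin> I\<close> by (simp add: 1 mult_ac)
  qed
  have "hl_sum q x S ((l # ls) @ ms) =
      (\<Sum>p\<in>S. \<Sum>I | I \<subseteq> S - {p} \<and> card I = length ls. ?f p I)"
    using Cons by (simp add: sum_distrib_left)
  also have "\<dots> = (\<Sum>(p, I)\<in>(SIGMA p:S. {I. I \<subseteq> S - {p} \<and> card I = length ls}). ?f p I)"
    using Cons.prems by (intro sum.Sigma) auto
  also have "\<dots> = (\<Sum>(I, p)\<in>(SIGMA I:{I. I \<subseteq> S \<and> card I = length (l # ls)}. I). ?g I p)"
  proof (rule sum.reindex_bij_witness[where i = "\<lambda>(I, p). (p, I - {p})"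
        and j = "\<lambda>(p, I). (insert p I, p)"])
    fix a assume "a \<in> (SIGMA p:S. {I. I \<subseteq> S - {p} \<and> card I = length ls})"
    then obtain p I where a: "a = (p, I)" "p \<in> S" "I \<subseteq> S - {p}" "card I = length ls" by auto
    then have fin: "finite I" "p \<notin> I" using Cons.prems finite_subset by auto
    show "(case case a of (p, I) \<Rightarrow> (insert p I, p) of (I, p) \<Rightarrow> (p, I - {p})) = a"
      using a fin by auto
    show "(case a of (p, I) \<Rightarrow> (insert p I, p)) \<in> (SIGMA I:{I. I \<subseteq> S \<and> card I = length (l # ls)}. I)"
      using a fin by auto
    show "(case case a of (p, I) \<Rightarrow> (insert p I, p) of (I, p) \<Rightarrow> ?g I p) = (case a of (p, I) \<Rightarrow> ?f p I)"
      using a eq by simp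
  next
    fix b assume "b \<in> (SIGMA I:{I. I \<subseteq> S \<and> card I = length (l # ls)}. I)"
    then obtain I p where b: "b = (I, p)" "I \<subseteq> S" "card I = Suc (length ls)" "p \<in> I" by auto
    then have fin: "finite I" using Cons.prems finite_subset by auto
    show "(case case b of (I, p) \<Rightarrow> (p, I - {p}) of (p, I) \<Rightarrow> (insert p I, p)) = b"
      using b by auto
    show "(case b of (I, p) \<Rightarrow> (p, I - {p})) \<in> (SIGMA p:S. {I. I \<subseteq> S - {p} \<and> card I = length ls})"
      using b fin by auto
  qed
  also have "\<dots> = (\<Sum>I | I \<subseteq> S \<and> card I = length (l # ls). \<Sum>p\<in>I. ?g I p)"
    using Cons.prems finite_subset by (intro sum.Sigma[symmetric]) auto
  also have "\<dots> = (\<Sum>I | I \<subseteq> S \<and> card I = length (l # ls).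
      hl_sum q x I (l # ls) * cross q x I (S - I) * hl_sum q x (S - I) ms)"
    by (simp add: sum_distrib_right)
  finally show ?case .
qed

text \<open>The list has \<open>card S\<close> entries, so every variable of \<open>S\<close> is
  used exactly once.\<close>

lemma hl_sum_map_Suc:
  assumes "finite S" "length ls = card S"
  shows "hl_sum q x S (map Suc ls) = (\<Prod>i\<in>S. x i) * hl_sum q x S ls"
  using assms
proof (induction ls arbitrary: S)
  case (Cons l ls)
  have "hl_sum q x (S - {p}) (map Suc ls) = (\<Prod>i\<in>S - {p}. x i) * hl_sum q x (S - {p}) ls"
    if "p \<in> S" for p
    using that Cons.prems by (intro Cons.IH) auto
  moreover have "(\<Prod>i\<in>S. x i) = x p * (\<Prod>i\<in>S - {p}. x i)" if "p \<in> S" for p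
    using that Cons.prems by (intro prod.remove)
  ultimately show ?case
    by (auto simp: sum_distrib_left mult_ac intro!: sum.cong)
qed simp

text \<open>Each choice of a first variable contributes a \<open>q\<close>-integer by
  \<open>sum_cross_singleton\<close>; their product is the \<open>q\<close>-factorial.\<close>

lemma hl_sum_replicate_0:
  fixes q :: "'a::field"
  assumes "finite S" "inj_on x S" "q \<noteq> 0" "q \<noteq> 1" "\<forall>i\<in>S. x i \<noteq> 0"
  shows "hl_sum q x S (replicate (card S) 0) = qpoch q q (card S) / (1 - q) ^ card S"
  using assms(1,2,5)
proof (induction "card S" arbitrary: S)
  case 0
  then show ?case by (simp add: qpoch_def)
next
  case (Suc s)
  have "hl_sum q x (S - {p}) (replicate s 0) = qpoch q q s / (1 - q) ^ s" if "p \<in> S" for p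
  proof -
    have "s = card (S - {p})" using that Suc by simp
    with Suc.hyps(1)[of "S - {p}"] Suc.prems show ?thesis by (simp add: inj_on_diff)
  qed
  then have "hl_sum q x S (replicate (card S) 0) =
      (\<Sum>p\<in>S. cross q x {p} (S - {p})) * (qpoch q q s / (1 - q) ^ s)"
    unfolding Suc.hyps(2)[symmetric] by (simp add: sum_distrib_right sum_divide_distrib)
  also have "\<dots> = (1 - q ^ Suc s) / (1 - q) * (qpoch q q s / (1 - q) ^ s)"
    using Suc assms by (subst sum_cross_singleton) auto
  also have "\<dots> = qpoch q q (card S) / (1 - q) ^ card S"
    unfolding Suc.hyps(2)[symmetric] by (simp add: qpoch_def)
  finally show ?case .
qed

section \<open>The sum over permutations as a recursive sum over orderings\<close>

fun hl_term :: "'a::field \<Rightarrow> (nat \<Rightarrow> 'a) \<Rightarrow> nat list \<Rightarrow> nat list \<Rightarrow> 'a" where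
  "hl_term q x (z # zs) (l # ls) = x z ^ l * cross q x {z} (set zs) * hl_term q x zs ls"
| "hl_term q x _ _ = 1"

lemma sum_hl_term:
  assumes "finite S" "length ls = card S"
  shows "(\<Sum>zs\<in>permutations_of_set S. hl_term q x zs ls) = hl_sum q x S ls"
  using assms
proof (induction ls arbitrary: S)
  case (Cons l ls)
  have "(\<Sum>zs\<in>permutations_of_set S. hl_term q x zs (l # ls)) =
      (\<Sum>p\<in>S. \<Sum>zs\<in>(\<lambda>zs. p # zs) ` permutations_of_set (S - {p}). hl_term q x zs (l # ls))"
    using Cons.prems by (subst permutations_of_set_nonempty) (auto intro!: sum.UNION_disjoint)
  also have "\<dots> = hl_sum q x S (l # ls)"
    unfolding hl_sum.simps
  proof (rule sum.cong[OF refl])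
    fix p assume p: "p \<in> S"
    have "(\<Sum>zs\<in>(\<lambda>zs. p # zs) ` permutations_of_set (S - {p}). hl_term q x zs (l # ls)) =
        (\<Sum>zs\<in>permutations_of_set (S - {p}). x p ^ l * cross q x {p} (S - {p}) * hl_term q x zs ls)"
      by (subst sum.reindex) (auto intro!: sum.cong simp: permutations_of_setD)
    also have "\<dots> = x p ^ l * cross q x {p} (S - {p}) * hl_sum q x (S - {p}) ls"
      using p Cons by (simp flip: sum_distrib_left)
    finally show "(\<Sum>zs\<in>(\<lambda>zs. p # zs) ` permutations_of_set (S - {p}). hl_term q x zs (l # ls)) =
      x p ^ l * cross q x {p} (S - {p}) * hl_sum q x (S - {p}) ls" .
  qed
  finally show ?case .
qed simp

text \<open>Surjectivity follows from injectivity, since both sets have the same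
  cardinality.\<close>

lemma bij_betw_permutes_permutations_of_set:
  "bij_betw (\<lambda>w. map w [1..<Suc n]) {w. w permutes {1..n}} (permutations_of_set {1..n})"
proof -
  let ?F = "\<lambda>w. map w [1..<Suc n]"
  have set: "set [1..<Suc n] = {1..n}" by auto
  have inj: "inj_on ?F {w. w permutes {1..n}}"
  proof (rule inj_onI)
    fix v w assume vw: "v \<in> {w. w permutes {1..n}}" "w \<in> {w. w permutes {1..n}}" "?F v = ?F w"
    show "v = w"
    proof
      fix i
      show "v i = w i"
      proof (cases "i \<in> {1..n}")
        case True
        then show ?thesis using vw(3) unfolding map_eq_conv set by blast
      next
        case False
        then show ?thesis using vw by (simp add: permutes_not_in)
      qed
    qed
  qed
  have sub: "?F ` {w. w permutes {1..n}} \<subseteq> permutations_of_set {1..n}"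
  proof clarify
    fix w assume w: "w permutes {1..n}"
    show "?F w \<in> permutations_of_set {1..n}"
    proof
      show "set (?F w) = {1..n}" using permutes_image[OF w] set by (simp only: set_map)
      show "distinct (?F w)" using permutes_inj_on[OF w] by (simp add: distinct_map)
    qed
  qed
  have "card (?F ` {w. w permutes {1..n}}) = card (permutations_of_set {1..n})"
    using inj by (simp add: card_image card_permutations)
  then have "?F ` {w. w permutes {1..n}} = permutations_of_set {1..n}"
    using sub by (intro card_subset_eq) auto
  with inj show ?thesis by (simp add: bij_betw_def)
qed

text \<open>The free lower end \<open>m\<close> allows an induction downwards from
  \<open>m = Suc n\<close>, where both lists are empty.\<close>

lemma hl_term_map:
  assumes "inj_on w {m..n}" "m \<le> Suc n"
  shows "hl_term q x (map w [m..<Suc n]) (map lam [m..<Suc n]) =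
    (\<Prod>i=m..n. x (w i) ^ lam i * (\<Prod>j=Suc i..n. (x (w i) - q * x (w j)) / (x (w i) - x (w j))))"
  using assms(2,1)
proof (induction m rule: inc_induct)
  case (step m)
  have "m \<le> n" using step by simp
  then have u: "[m..<Suc n] = m # [Suc m..<Suc n]" by (simp add: upt_conv_Cons del: upt_Suc)
  have "inj_on w {Suc m..n}" using step.prems by (rule inj_on_subset) auto
  moreover have "set [Suc m..<Suc n] = {Suc m..n}" by auto
  ultimately have c: "cross q x {w m} (set (map w [Suc m..<Suc n])) =
      (\<Prod>j=Suc m..n. (x (w m) - q * x (w j)) / (x (w m) - x (w j)))"
    unfolding cross_def set_map by (simp add: prod.reindex)
  show ?case
    unfolding u list.map hl_term.simps c step.IH[OF \<open>inj_on w {Suc m..n}\<close>]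
    using \<open>m \<le> n\<close> by (simp add: prod.atLeast_Suc_atMost)
qed simp

lemma sum_permutes_eq_hl_sum:
  fixes q :: "'a::field"
  shows "(\<Sum>w | w permutes {1..n}. (\<Prod>i = 1..n. x (w i) ^ lam i) *
      (\<Prod>(i, j) \<in> {(i, j). i \<in> {1..n} \<and> j \<in> {1..n} \<and> i < j}.
         (x (w i) - q * x (w j)) / (x (w i) - x (w j)))) =
    hl_sum q x {1..n} (map lam [1..<Suc n])"
    (is "(\<Sum>w | w permutes _. ?f w) = _")
proof -
  have *: "?f w = hl_term q x (map w [1..<Suc n]) (map lam [1..<Suc n])" if "w permutes {1..n}" for w
  proof -
    have "{(i, j). i \<in> {1..n} \<and> j \<in> {1..n} \<and> i < j} = (SIGMA i:{1..n}. {Suc i..n})" by auto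
    then show ?thesis
      using permutes_inj_on[OF that]
      by (subst hl_term_map) (simp_all add: prod.distrib prod.Sigma)
  qed
  have "(\<Sum>w | w permutes {1..n}. ?f w) =
      (\<Sum>w | w permutes {1..n}. hl_term q x (map w [1..<Suc n]) (map lam [1..<Suc n]))"
    using * by (intro sum.cong) auto
  also have "\<dots> = (\<Sum>zs\<in>permutations_of_set {1..n}. hl_term q x zs (map lam [1..<Suc n]))"
    by (rule sum.reindex_bij_betw[OF bij_betw_permutes_permutations_of_set])
  also have "\<dots> = hl_sum q x {1..n} (map lam [1..<Suc n])"
    by (rule sum_hl_term) auto
  finally show ?thesis .
qed

section \<open>Box partitions and the effect of adding a first column\<close>

lemma partition_nonzero_iff:
  assumes "is_partition lam" "1 \<le> i"
  shows "lam i \<noteq> 0 \<longleftrightarrow> i \<le> part_length lam"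
proof
  show "lam i \<noteq> 0 \<Longrightarrow> i \<le> part_length lam"
    using partition_zero_beyond_length[OF assms(1), of i] by (cases "part_length lam < i") auto
  show "lam i \<noteq> 0" if "i \<le> part_length lam"
  proof
    assume zero: "lam i = 0"
    have "{j. 1 \<le> j \<and> lam j \<noteq> 0} \<subseteq> {1..<i}"
    proof
      fix j assume "j \<in> {j. 1 \<le> j \<and> lam j \<noteq> 0}"
      then show "j \<in> {1..<i}"
        using partition_antimono[OF assms, of j] zero by (cases "i \<le> j") auto
    qed
    then have "part_length lam \<le> card {1..<i}"
      unfolding part_length_def by (intro card_mono) auto
    then show False using that assms(2) by simp
  qed
qed

lemma part_length_eqI:
  assumes "\<And>i. 1 \<le> i \<Longrightarrow> lam i \<noteq> 0 \<longleftrightarrow> i \<le> l"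
  shows "part_length lam = l"
proof -
  have "{i. 1 \<le> i \<and> lam i \<noteq> 0} = {1..l}" using assms by auto
  then show ?thesis by (simp add: part_length_def)
qed

text \<open>The height \<open>l\<close> is an argument of its own because \<open>mu\<close> may have
  fewer than \<open>l\<close> nonzero parts; the missing ones become parts equal to 1.\<close>

definition add_column :: "nat \<Rightarrow> (nat \<Rightarrow> nat) \<Rightarrow> nat \<Rightarrow> nat" where
  "add_column l mu i = (if 1 \<le> i \<and> i \<le> l then Suc (mu i) else 0)"

lemma part_length_add_column [simp]: "part_length (add_column l mu) = l"
  by (rule part_length_eqI) (auto simp: add_column_def)

lemma bij_betw_add_column:
  "bij_betw (\<lambda>(l, mu). add_column l mu) (SIGMA l:{0..n}. partitions_in_box k l)
    (partitions_in_box (Suc k) n)"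
proof (rule bij_betwI[where g = "\<lambda>lam. (part_length lam, \<lambda>i. lam i - 1)"])
  show "(\<lambda>(l, mu). add_column l mu) \<in>
      (SIGMA l:{0..n}. partitions_in_box k l) \<rightarrow> partitions_in_box (Suc k) n"
  proof clarify
    fix l mu assume l: "l \<in> {0..n}" and mu: "mu \<in> partitions_in_box k l"
    have "{i. add_column l mu i \<noteq> 0} \<subseteq> {1..l}" by (auto simp: add_column_def split: if_splits)
    then have "finite {i. add_column l mu i \<noteq> 0}" using finite_subset by blast
    then have "is_partition (add_column l mu)"
      using mu by (auto simp: is_partition_def partitions_in_box_def add_column_def)
    moreover have "add_column l mu 1 \<le> Suc k"
      using mu by (auto simp: add_column_def partitions_in_box_def)
    ultimately show "add_column l mu \<in> partitions_in_box (Suc k) n"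
      using l by (simp add: partitions_in_box_def)
  qed
  show "(\<lambda>lam. (part_length lam, \<lambda>i. lam i - 1)) \<in>
      partitions_in_box (Suc k) n \<rightarrow> (SIGMA l:{0..n}. partitions_in_box k l)"
  proof
    fix lam assume "lam \<in> partitions_in_box (Suc k) n"
    then have lam: "is_partition lam" "lam 1 \<le> Suc k" "part_length lam \<le> n"
      by (auto simp: partitions_in_box_def)
    let ?mu = "\<lambda>i. lam i - 1"
    have "{i. ?mu i \<noteq> 0} \<subseteq> {i. lam i \<noteq> 0}" by auto
    then have "is_partition ?mu"
      using lam(1) finite_subset by (auto simp: is_partition_def diff_le_mono)
    moreover have "part_length ?mu \<le> part_length lam"
      using lam(1) unfolding part_length_def is_partition_def by (intro card_mono) auto
    ultimately have "?mu \<in> partitions_in_box k (part_length lam)"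
      using lam(2) by (simp add: partitions_in_box_def)
    then show "(part_length lam, ?mu) \<in> (SIGMA l:{0..n}. partitions_in_box k l)"
      using lam by simp
  qed
next
  fix a assume "a \<in> (SIGMA l:{0..n}. partitions_in_box k l)"
  then obtain l mu where a: "a = (l, mu)" "mu \<in> partitions_in_box k l" by auto
  have "add_column l mu i - 1 = mu i" for i
  proof (cases "1 \<le> i \<and> i \<le> l")
    case False
    then have "mu i = 0"
      using a partition_zero_beyond_length[of mu i]
      by (cases "i = 0") (auto simp: partitions_in_box_def is_partition_def)
    then show ?thesis using False by (auto simp: add_column_def)
  qed (auto simp: add_column_def)
  then show "(\<lambda>lam. (part_length lam, \<lambda>i. lam i - 1)) (case a of (l, mu) \<Rightarrow> add_column l mu) = a"
    using a by auto
next
  fix lam assume "lam \<in> partitions_in_box (Suc k) n"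
  then have lam: "is_partition lam" by (simp add: partitions_in_box_def)
  show "(case (part_length lam, \<lambda>i. lam i - 1) of (l, mu) \<Rightarrow> add_column l mu) = lam"
  proof (simp, rule ext)
    fix i
    show "add_column (part_length lam) (\<lambda>i. lam i - Suc 0) i = lam i"
      using partition_nonzero_iff[OF lam, of i] lam
      by (cases "i = 0") (auto simp: add_column_def is_partition_def)
  qed
qed

lemma sum_pred_eq_choose_2: "(\<Sum>i = 1..l. i - 1) = l choose 2"
  by (induction l) (auto simp: numeral_2_eq_2)

text \<open>The new column adds \<open>i - 1\<close> for each row \<open>i\<close> up to
  \<open>l\<close>; this is the source of the power of \<open>q\<close> in \<open>weight\<close>.
  Rows of \<open>mu\<close> beyond its length contribute 0.\<close>

lemma part_n_add_column:
  assumes "mu \<in> partitions_in_box k l"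
  shows "part_n (add_column l mu) = (l choose 2) + part_n mu"
proof -
  have "part_n (add_column l mu) = (\<Sum>i = 1..l. (i - 1) + (i - 1) * mu i)"
    by (simp add: part_n_def add_column_def)
  also have "\<dots> = (l choose 2) + (\<Sum>i = 1..l. (i - 1) * mu i)"
    unfolding sum.distrib sum_pred_eq_choose_2 ..
  also have "(\<Sum>i = 1..l. (i - 1) * mu i) = part_n mu"
    unfolding part_n_def
    using assms partition_zero_beyond_length[of mu]
    by (intro sum.mono_neutral_right) (auto simp: partitions_in_box_def)
  finally show ?thesis .
qed

lemma part_mult_add_column_0:
  assumes "l \<le> n"
  shows "part_mult n (add_column l mu) 0 = n - l"
proof -
  have "{j \<in> {1..n}. add_column l mu j = 0} = {Suc l..n}" by (auto simp: add_column_def)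
  then show ?thesis by (simp add: part_mult_def)
qed

text \<open>Here \<open>mu\<close> is viewed with \<open>l\<close> parts, so its zero parts count as
  the parts equal to 1 of the larger partition.\<close>

lemma part_mult_add_column_Suc:
  assumes "l \<le> n"
  shows "part_mult n (add_column l mu) (Suc i) = part_mult l mu i"
proof -
  have "{j \<in> {1..n}. add_column l mu j = Suc i} = {j \<in> {1..l}. mu j = i}"
    using assms by (auto simp: add_column_def split: if_splits)
  then show ?thesis by (simp add: part_mult_def)
qed

text \<open>The normalizing product runs up to the box bound \<open>k\<close> instead of the largest
  part, so that it shifts uniformly when a column is added. The extra factors are 1.\<close>

definition hl_poly :: "nat \<Rightarrow> 'a::field \<Rightarrow> (nat \<Rightarrow> 'a) \<Rightarrow> nat set \<Rightarrow> (nat \<Rightarrow> nat) \<Rightarrow> 'a" where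
  "hl_poly k q x S lam =
    (\<Prod>i\<le>k. (1 - q) ^ part_mult (card S) lam i / qpoch q q (part_mult (card S) lam i)) *
    hl_sum q x S (map lam [1..<Suc (card S)])"

lemma hall_littlewood_P_eq_hl_poly:
  assumes "lam \<in> partitions_in_box k n"
  shows "hall_littlewood_P n lam x q = hl_poly k q x {1..n} lam"
proof -
  have "part_mult n lam i = 0" if "lam 1 < i" for i
  proof -
    have "lam j < i" if "1 \<le> j" for j
      using partition_antimono[of lam 1 j] that assms \<open>lam 1 < i\<close>
      by (auto simp: partitions_in_box_def)
    then have "{j \<in> {1..n}. lam j = i} = {}" by fastforce
    then show ?thesis by (simp only: part_mult_def card.empty)
  qed
  then have "(\<Prod>i\<le>k. (1 - q) ^ part_mult n lam i / qpoch q q (part_mult n lam i)) =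
      (\<Prod>i=0..lam 1. (1 - q) ^ part_mult n lam i / qpoch q q (part_mult n lam i))"
    using assms by (intro prod.mono_neutral_right) (auto simp: partitions_in_box_def qpoch_def)
  then show ?thesis
    unfolding hall_littlewood_P_def hl_poly_def sum_permutes_eq_hl_sum by simp
qed

lemma qpoch_self_nonzero:
  fixes q :: "'a::field"
  assumes "\<forall>r\<in>{1..n}. q ^ r \<noteq> 1" "m \<le> n"
  shows "qpoch q q m \<noteq> 0"
proof -
  have "1 - q * q ^ j \<noteq> 0" if "j < m" for j
    using assms that by (auto dest: bspec[of _ _ "Suc j"])
  then show ?thesis by (simp add: qpoch_def)
qed

text \<open>\<open>T\<close> is the full set of variables. The conditions pass to the subsets that
  the recursion visits, and \<open>roots\<close> keeps the normalizing denominators nonzero for all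
  of them.\<close>

locale hl_point =
  fixes q :: "'a::field" and x :: "nat \<Rightarrow> 'a" and T :: "nat set"
  assumes fin: "finite T" and inj: "inj_on x T" and q0: "q \<noteq> 0" and q1: "q \<noteq> 1"
    and roots: "\<forall>r\<in>{1..card T}. q ^ r \<noteq> 1" and x0: "\<forall>i\<in>T. x i \<noteq> 0"
begin

lemma hl_sum_zeros:
  assumes "S \<subseteq> T"
  shows "(1 - q) ^ card S / qpoch q q (card S) * hl_sum q x S (replicate (card S) 0) = 1"
proof -
  have "card S \<le> card T" using assms fin by (rule card_mono[rotated])
  then have "qpoch q q (card S) \<noteq> 0" by (rule qpoch_self_nonzero[OF roots])
  moreover have "hl_sum q x S (replicate (card S) 0) = qpoch q q (card S) / (1 - q) ^ card S"
    using assms fin inj q0 q1 x0 finite_subset inj_on_subset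
    by (intro hl_sum_replicate_0) blast+
  ultimately show ?thesis using q1 by simp
qed

text \<open>The exponent list is that of \<open>mu\<close> raised by 1, followed by zeros.
  \<open>hl_sum_append\<close> separates the two blocks, and by \<open>hl_sum_zeros\<close> the zero
  block cancels against its normalizing factor.\<close>

lemma hl_poly_add_column:
  assumes S: "S \<subseteq> T" and l: "l \<le> card S"
  shows "hl_poly (Suc k) q x S (add_column l mu) =
    (\<Sum>I | I \<subseteq> S \<and> card I = l. (\<Prod>i\<in>I. x i) * cross q x I (S - I) * hl_poly k q x I mu)"
proof -
  let ?N = "\<Prod>i\<le>k. (1 - q) ^ part_mult l mu i / qpoch q q (part_mult l mu i)"
  let ?ms = "map mu [1..<Suc l]"
  have finS: "finite S" using S fin finite_subset by blast
  let ?Z = "(1 - q) ^ (card S - l) / qpoch q q (card S - l)"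
  have "map (add_column l mu) [1..<Suc (card S)] = map Suc ?ms @ replicate (card S - l) 0"
    using l by (intro nth_equalityI)
      (auto simp: nth_append add_column_def simp del: upt_Suc)
  then have "hl_poly (Suc k) q x S (add_column l mu) = ?Z * ?N *
    (\<Sum>I | I \<subseteq> S \<and> card I = l. hl_sum q x I (map Suc ?ms) * cross q x I (S - I) *
      hl_sum q x (S - I) (replicate (card S - l) 0))"
    unfolding hl_poly_def prod.atMost_Suc_shift part_mult_add_column_0[OF l]
      part_mult_add_column_Suc[OF l]
    using finS by (simp add: hl_sum_append del: upt_Suc)
  also have "\<dots> = (\<Sum>I | I \<subseteq> S \<and> card I = l.
      (\<Prod>i\<in>I. x i) * cross q x I (S - I) * hl_poly k q x I mu)"
    unfolding sum_distrib_left
  proof (rule sum.cong[OF refl], clarify)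
    fix I assume I: "I \<subseteq> S" "l = card I"
    have "card (S - I) = card S - l"
      using I finS finite_subset card_Diff_subset by blast
    then have Z: "?Z * hl_sum q x (S - I) (replicate (card S - l) 0) = 1"
      using hl_sum_zeros[of "S - I"] S by auto
    have "hl_sum q x I (map Suc ?ms) = (\<Prod>i\<in>I. x i) * hl_sum q x I ?ms"
      using I finS finite_subset by (intro hl_sum_map_Suc) auto
    then have "?Z * ?N * (hl_sum q x I (map Suc ?ms) * cross q x I (S - I) *
        hl_sum q x (S - I) (replicate (card S - l) 0)) =
      (?Z * hl_sum q x (S - I) (replicate (card S - l) 0)) *
      ((\<Prod>i\<in>I. x i) * cross q x I (S - I) * (?N * hl_sum q x I ?ms))"
      by (simp add: mult_ac)
    also have "\<dots> = (\<Prod>i\<in>I. x i) * cross q x I (S - I) * (?N * hl_sum q x I ?ms)"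
      unfolding Z by simp
    finally show "(1 - q) ^ (card S - card I) / qpoch q q (card S - card I) *
        (\<Prod>i\<le>k. (1 - q) ^ part_mult (card I) mu i / qpoch q q (part_mult (card I) mu i)) *
        (hl_sum q x I (map Suc (map mu [1..<Suc (card I)])) * cross q x I (S - I) *
        hl_sum q x (S - I) (replicate (card S - card I) 0)) =
        (\<Prod>i\<in>I. x i) * cross q x I (S - I) * hl_poly k q x I mu"
      unfolding hl_poly_def I(2) .
  qed
  finally show ?thesis .
qed

text \<open>\<open>f\<close> and \<open>g\<close> are kept apart because the recursion treats them
  differently: removing a column consumes \<open>f\<close> and hands \<open>g\<close> on.\<close>

definition box_sum :: "(nat \<Rightarrow> 'a) \<Rightarrow> nat \<Rightarrow> (nat \<Rightarrow> 'a) \<Rightarrow> nat set \<Rightarrow> 'a" where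
  "box_sum f k g S = (\<Sum>lam\<in>partitions_in_box k (card S). q ^ part_n lam *
    f (part_length lam) * g (part_mult (card S) lam k) * hl_poly k q x S lam)"

definition weight :: "nat set \<Rightarrow> 'a" where
  "weight I = q ^ (card I choose 2) * (\<Prod>i\<in>I. x i)"

text \<open>Only the empty partition is left, and the multiplicity of the bound 0 counts all
  \<open>card S\<close> zero parts.\<close>

lemma box_sum_0:
  assumes "S \<subseteq> T"
  shows "box_sum (\<lambda>_. 1) 0 g S = g (card S)"
proof -
  have "lam i = 0" if "is_partition lam" "lam 1 = 0" for lam i
    using that partition_antimono[of lam 1 i] by (cases "i = 0") (auto simp: is_partition_def)
  then have "lam = (\<lambda>_. 0)" if "is_partition lam" "lam 1 = 0" for lam using that by blast
  then have "partitions_in_box 0 (card S) = {\<lambda>_. 0}"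
    by (auto simp: partitions_in_box_def is_partition_def part_length_def)
  moreover have m: "part_mult (card S) (\<lambda>_. 0) 0 = card S"
  proof -
    have "{j \<in> {1..card S}. (0::nat) = 0} = {1..card S}" by auto
    then show ?thesis unfolding part_mult_def by simp
  qed
  moreover have "hl_poly 0 q x S (\<lambda>_. 0) = 1"
    using hl_sum_zeros[OF assms] by (simp add: hl_poly_def m map_replicate_const del: upt_Suc)
  ultimately show ?thesis by (simp add: box_sum_def part_n_def)
qed

lemma box_sum_Suc:
  assumes S: "S \<subseteq> T"
  shows "box_sum f (Suc k) g S = (\<Sum>I\<in>Pow S. f (card I) * weight I * cross q x I (S - I) *
    box_sum (\<lambda>_. 1) k g I)"
proof -
  let ?h = "\<lambda>I mu. f (card I) * weight I * cross q x I (S - I) *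
    (q ^ part_n mu * g (part_mult (card I) mu k) * hl_poly k q x I mu)"
  have finS: "finite S" using S fin finite_subset by blast
  have "box_sum f (Suc k) g S = (\<Sum>(l, mu)\<in>(SIGMA l:{0..card S}. partitions_in_box k l).
    q ^ part_n (add_column l mu) * f (part_length (add_column l mu)) *
    g (part_mult (card S) (add_column l mu) (Suc k)) * hl_poly (Suc k) q x S (add_column l mu))"
    unfolding box_sum_def
    by (subst sum.reindex_bij_betw[OF bij_betw_add_column, symmetric]) (simp add: case_prod_unfold)
  also have "\<dots> = (\<Sum>l = 0..card S. \<Sum>mu\<in>partitions_in_box k l.
    q ^ part_n (add_column l mu) * f (part_length (add_column l mu)) *
    g (part_mult (card S) (add_column l mu) (Suc k)) * hl_poly (Suc k) q x S (add_column l mu))"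
    by (rule sum.Sigma[symmetric]) (auto simp: finite_partitions_in_box)
  also have "\<dots> = (\<Sum>l = 0..card S. \<Sum>mu\<in>partitions_in_box k l. \<Sum>I | I \<subseteq> S \<and> card I = l. ?h I mu)"
  proof (intro sum.cong refl)
    fix l mu assume l: "l \<in> {0..card S}" and mu: "mu \<in> partitions_in_box k l"
    have "q ^ part_n (add_column l mu) * f (part_length (add_column l mu)) *
        g (part_mult (card S) (add_column l mu) (Suc k)) * hl_poly (Suc k) q x S (add_column l mu) =
      q ^ (l choose 2) * q ^ part_n mu * f l * g (part_mult l mu k) *
      (\<Sum>I | I \<subseteq> S \<and> card I = l. (\<Prod>i\<in>I. x i) * cross q x I (S - I) * hl_poly k q x I mu)"
      using l by (simp add: part_n_add_column[OF mu] part_mult_add_column_Suc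
          hl_poly_add_column[OF S] power_add)
    also have "\<dots> = (\<Sum>I | I \<subseteq> S \<and> card I = l. ?h I mu)"
      unfolding sum_distrib_left
      by (intro sum.cong refl) (auto simp: weight_def mult_ac)
    finally show "q ^ part_n (add_column l mu) * f (part_length (add_column l mu)) *
        g (part_mult (card S) (add_column l mu) (Suc k)) * hl_poly (Suc k) q x S (add_column l mu) =
      (\<Sum>I | I \<subseteq> S \<and> card I = l. ?h I mu)" .
  qed
  also have "\<dots> = (\<Sum>l = 0..card S. \<Sum>I | I \<subseteq> S \<and> card I = l. \<Sum>mu\<in>partitions_in_box k (card I). ?h I mu)"
    by (intro sum.cong refl, subst sum.swap) (auto intro!: sum.cong)
  also have "\<dots> = (\<Sum>l = 0..card S. \<Sum>I | I \<in> Pow S \<and> card I = l. \<Sum>mu\<in>partitions_in_box k (card I). ?h I mu)"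
    by simp
  also have "\<dots> = (\<Sum>I\<in>Pow S. \<Sum>mu\<in>partitions_in_box k (card I). ?h I mu)"
    using finS by (intro sum.group) (auto intro: card_mono)
  also have "\<dots> = (\<Sum>I\<in>Pow S. f (card I) * weight I * cross q x I (S - I) *
      box_sum (\<lambda>_. 1) k g I)"
    unfolding box_sum_def sum_distrib_left by simp
  finally show ?thesis .
qed

end

section \<open>Diagonalization of the transfer operator\<close>

lemma add_choose_2: "(m + r) choose 2 = (m choose 2) + (r choose 2) + m * r"
  by (induction r) (auto simp: numeral_2_eq_2)

lemma qpoch_add: "qpoch a t (m + r) = qpoch a t m * qpoch (a * t ^ m) t r"
proof -
  have "(\<Prod>j<m + r. 1 - a * t ^ j) = (\<Prod>j<m. 1 - a * t ^ j) * (\<Prod>j<r. 1 - a * t ^ (m + j))"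
    by (induction r) (simp_all add: mult.assoc)
  then show ?thesis by (simp add: qpoch_def power_add mult.assoc)
qed

text \<open>The power of \<open>q\<close> clears the negative powers in the Pochhammer symbol,
  giving the form used in \<open>sum_cross_binomial\<close>.\<close>

lemma power_choose_2_qpoch_inverse:
  fixes q :: "'a::field"
  assumes "q \<noteq> 0"
  shows "q ^ (r choose 2) * qpoch b (inverse q) r = (\<Prod>j<r. q ^ j - b)"
proof (induction r)
  case (Suc r)
  have "Suc r choose 2 = (r choose 2) + r" by (simp add: numeral_2_eq_2)
  moreover have "q ^ r * (1 - b * inverse q ^ r) = q ^ r - b"
    using assms by (simp add: algebra_simps flip: power_mult_distrib)
  ultimately have "q ^ (Suc r choose 2) * qpoch b (inverse q) (Suc r) =
      (q ^ (r choose 2) * qpoch b (inverse q) r) * (q ^ r - b)"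
    by (simp add: qpoch_def power_add mult_ac)
  then show ?case using Suc by simp
qed (simp add: qpoch_def numeral_2_eq_2)

text \<open>The exponents \<open>r = card J\<close> and \<open>r = card J - 1\<close> keep the
  denominators of \<open>eig\<close> and \<open>eig_coeff\<close> nonzero.\<close>

locale hl_generic_point = hl_point +
  assumes generic: "\<forall>i\<in>T. \<forall>r<card T. x i * q ^ r \<noteq> 1"
begin

text \<open>For fixed \<open>J\<close>, \<open>eig J\<close> is an eigenvector, with eigenvalue \<open>weight J\<close>, of the transfer operator
  of \<open>box_sum_Suc\<close>; this is the case \<open>a = 0\<close> of the next lemma.\<close>

definition eig :: "nat set \<Rightarrow> nat set \<Rightarrow> 'a" where
  "eig J S = cross q x J (S - J) * (\<Prod>j\<in>S - J. 1 / (1 - x j * q ^ card J))"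

text \<open>Once the factors depending on \<open>J\<close> alone are pulled out, what remains is
  \<open>sum_cross_binomial\<close> on \<open>S - J\<close> at \<open>c = 1\<close>.\<close>

lemma sum_qpoch_eig:
  assumes S: "S \<subseteq> T" and J: "J \<subseteq> S"
  shows "(\<Sum>K\<in>Pow (S - J). qpoch a (inverse q) (card (J \<union> K)) * weight (J \<union> K) *
      cross q x (J \<union> K) (S - (J \<union> K)) * eig J (J \<union> K)) =
    qpoch a (inverse q) (card J) * weight J * cross q x J (S - J) *
      (\<Prod>j\<in>S - J. (1 - a * x j) / (1 - x j * q ^ card J))"
proof -
  let ?m = "card J" and ?R = "S - J"
  \<comment> \<open>\<open>y\<close> absorbs the mixed term \<open>card J * card K\<close> of the
    binomial coefficient of \<open>card J + card K\<close>, and \<open>b\<close> is the base of the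
    remaining Pochhammer symbol.\<close>
  define y where "y = (\<lambda>i. q ^ ?m * x i)"
  define b where "b = a * inverse q ^ ?m"
  have finS: "finite S" using S fin by (rule finite_subset)
  have finJ: "finite J" using J finS by (rule finite_subset)
  have qm: "q ^ ?m \<noteq> 0" using q0 by simp
  have y1: "1 - y i \<noteq> 0" if "i \<in> ?R" for i
  proof -
    have "J \<subset> T" using S J that by auto
    then have "?m < card T" using fin by (rule psubset_card_mono[rotated])
    then show ?thesis using generic S that by (auto simp: y_def mult.commute)
  qed
  let ?C = "qpoch a (inverse q) ?m * weight J * cross q x J ?R * (\<Prod>i\<in>?R. 1 / (1 - y i))"
  have "(\<Sum>K\<in>Pow ?R. qpoch a (inverse q) (card (J \<union> K)) * weight (J \<union> K) *
      cross q x (J \<union> K) (S - (J \<union> K)) * eig J (J \<union> K)) =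
    (\<Sum>K\<in>Pow ?R. ?C * ((\<Prod>j<card K. q ^ j - b) * (\<Prod>i\<in>K. y i) * cross q y K (?R - K) *
      (\<Prod>j\<in>?R - K. 1 - y j)))"
  proof (rule sum.cong[OF refl])
    fix K assume "K \<in> Pow ?R"
    then have K: "K \<subseteq> ?R" "finite K" "J \<inter> K = {}" using finS finite_subset by auto
    have D: "S - (J \<union> K) = ?R - K" "J \<union> K - J = K" using K by auto
    have RK: "?R = K \<union> (?R - K)" using K by auto
    have c: "card (J \<union> K) = ?m + card K" using K finJ by (simp add: card_Un_disjoint)
    have 1: "cross q x (J \<union> K) (?R - K) * cross q x J K = cross q x J ?R * cross q y K (?R - K)"
    proof -
      have "cross q x J ?R = cross q x J K * cross q x J (?R - K)"
        by (subst RK, rule cross_Un_right) (use K finS in auto)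
      moreover have "cross q x (J \<union> K) (?R - K) = cross q x J (?R - K) * cross q x K (?R - K)"
        by (rule cross_Un_left) (use K finJ in auto)
      ultimately show ?thesis by (simp add: y_def cross_scale[OF qm])
    qed
    \<comment> \<open>Completing the product over \<open>K\<close> to all of \<open>S - J\<close>
      supplies the factors \<open>c - y j\<close> at \<open>c = 1\<close>.\<close>
    have 2: "(\<Prod>i\<in>K. 1 / (1 - x i * q ^ ?m)) = (\<Prod>i\<in>?R. 1 / (1 - y i)) * (\<Prod>i\<in>?R - K. 1 - y i)"
    proof -
      have "(\<Prod>i\<in>?R. 1 / (1 - y i)) = (\<Prod>i\<in>K. 1 / (1 - y i)) * (\<Prod>i\<in>?R - K. 1 / (1 - y i))"
        by (subst RK, rule prod.union_disjoint) (use K finS in auto)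
      moreover have "(\<Prod>i\<in>?R - K. 1 / (1 - y i)) * (\<Prod>i\<in>?R - K. 1 - y i) = 1"
        using y1 by (simp flip: prod.distrib)
      ultimately show ?thesis by (simp add: y_def mult.commute)
    qed
    have 3: "qpoch a (inverse q) (card (J \<union> K)) * weight (J \<union> K) =
        qpoch a (inverse q) ?m * weight J * ((\<Prod>j<card K. q ^ j - b) * (\<Prod>i\<in>K. y i))"
    proof -
      have "(\<Prod>i\<in>J \<union> K. x i) = (\<Prod>i\<in>J. x i) * (\<Prod>i\<in>K. x i)"
        using K finJ by (intro prod.union_disjoint) auto
      then show ?thesis
        unfolding power_choose_2_qpoch_inverse[OF q0, symmetric] weight_def c qpoch_add
          add_choose_2 b_def
        by (simp add: y_def prod.distrib power_add power_mult mult_ac)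
    qed
    have "qpoch a (inverse q) (card (J \<union> K)) * weight (J \<union> K) *
        cross q x (J \<union> K) (S - (J \<union> K)) * eig J (J \<union> K) =
      (qpoch a (inverse q) (card (J \<union> K)) * weight (J \<union> K)) *
        (cross q x (J \<union> K) (?R - K) * cross q x J K) * (\<Prod>i\<in>K. 1 / (1 - x i * q ^ ?m))"
      by (simp only: eig_def D mult_ac)
    also have "\<dots> = ?C * ((\<Prod>j<card K. q ^ j - b) * (\<Prod>i\<in>K. y i) * cross q y K (?R - K) *
        (\<Prod>j\<in>?R - K. 1 - y j))"
      unfolding 1 2 3 by (simp only: mult_ac)
    finally show "qpoch a (inverse q) (card (J \<union> K)) * weight (J \<union> K) *
        cross q x (J \<union> K) (S - (J \<union> K)) * eig J (J \<union> K) =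
      ?C * ((\<Prod>j<card K. q ^ j - b) * (\<Prod>i\<in>K. y i) * cross q y K (?R - K) *
        (\<Prod>j\<in>?R - K. 1 - y j))" .
  qed
  also have "\<dots> = ?C * (\<Prod>j\<in>?R. 1 - b * y j)"
  proof -
    have "inj_on y ?R"
      using inj S qm by (auto simp: y_def inj_on_def)
    then show ?thesis
      unfolding sum_distrib_left[symmetric] using finS q0 by (subst sum_cross_binomial) auto
  qed
  also have "\<dots> = qpoch a (inverse q) ?m * weight J * cross q x J ?R *
      (\<Prod>j\<in>?R. 1 / (1 - y j) * (1 - b * y j))"
    by (simp only: prod.distrib mult.assoc)
  also have "(\<Prod>j\<in>?R. 1 / (1 - y j) * (1 - b * y j)) =
      (\<Prod>j\<in>?R. (1 - a * x j) / (1 - x j * q ^ ?m))"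
  proof (rule prod.cong[OF refl])
    fix j
    have "b * y j = a * x j * (inverse q ^ ?m * q ^ ?m)" by (simp only: b_def y_def mult_ac)
    also have "\<dots> = a * x j" using q0 by (simp flip: power_mult_distrib)
    finally show "1 / (1 - y j) * (1 - b * y j) = (1 - a * x j) / (1 - x j * q ^ ?m)"
      by (simp add: y_def mult.commute)
  qed
  finally show ?thesis .
qed

lemma weight_eig:
  assumes "S \<subseteq> T" "J \<subseteq> S"
  shows "(\<Sum>K\<in>Pow (S - J). weight (J \<union> K) * cross q x (J \<union> K) (S - (J \<union> K)) * eig J (J \<union> K)) =
    weight J * eig J S"
  using sum_qpoch_eig[OF assms, of 0] by (simp add: qpoch_def eig_def mult.assoc)

text \<open>The upper end stays at \<open>card T\<close> for every subset, as the initial function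
  refers to the total number of variables.\<close>

definition tail :: "'a \<Rightarrow> nat \<Rightarrow> 'a" where
  "tail e m = (\<Prod>j=m..<card T. 1 - e * q ^ j)"

definition eig_coeff :: "'a \<Rightarrow> nat set \<Rightarrow> 'a" where
  "eig_coeff e J = tail e (card J) * (\<Prod>i\<in>J. (x i - e) / (x i - inverse q ^ (card J - 1)))"

text \<open>\<open>tail e (card S)\<close> divides every \<open>tail e (card J)\<close>; the
  quotients are the factors needed in \<open>sum_cross_partition_of_unity\<close>. The coefficients
  \<open>eig_coeff e J\<close> do not depend on \<open>S\<close>.\<close>

lemma tail_expansion:
  assumes S: "S \<subseteq> T"
  shows "tail e (card S) = (\<Sum>J\<in>Pow S. eig_coeff e J * eig J S)"
proof -
  have finS: "finite S" using S fin finite_subset by blast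
  have le: "card S \<le> card T" using S fin by (rule card_mono[rotated])
  have "(\<Sum>J\<in>Pow S. eig_coeff e J * eig J S) =
    tail e (card S) * (\<Sum>J\<in>Pow S. (\<Prod>j=card J..<card S. 1 - e * q ^ j) *
      (\<Prod>i\<in>J. (x i - e) / (x i - inverse q ^ (card J - 1))) *
      (\<Prod>i\<in>S - J. 1 / (1 - x i * q ^ card J)) * cross q x J (S - J))"
    unfolding sum_distrib_left
  proof (rule sum.cong[OF refl])
    fix J assume "J \<in> Pow S"
    then have "card J \<le> card S" using finS by (auto intro: card_mono)
    then have "tail e (card J) = (\<Prod>j=card J..<card S. 1 - e * q ^ j) * tail e (card S)"
      unfolding tail_def using le by (simp add: prod.atLeastLessThan_concat)
    then show "eig_coeff e J * eig J S = tail e (card S) * ((\<Prod>j=card J..<card S. 1 - e * q ^ j) *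
      (\<Prod>i\<in>J. (x i - e) / (x i - inverse q ^ (card J - 1))) *
      (\<Prod>i\<in>S - J. 1 / (1 - x i * q ^ card J)) * cross q x J (S - J))"
      by (simp only: eig_coeff_def eig_def mult_ac)
  qed
  also have "\<dots> = tail e (card S)"
    using finS S inj q0 generic le inj_on_subset
    by (subst sum_cross_partition_of_unity) (auto simp: subset_iff)
  finally show ?thesis ..
qed

lemma box_sum_expansion:
  assumes "S \<subseteq> T"
  shows "box_sum (\<lambda>_. 1) k (tail e) S = (\<Sum>J\<in>Pow S. weight J ^ k * eig_coeff e J * eig J S)"
  using assms
proof (induction k arbitrary: S)
  case 0
  then show ?case by (simp add: box_sum_0 tail_expansion)
next
  case (Suc k)
  let ?w = "\<lambda>I. weight I * cross q x I (S - I)"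
  have finS: "finite S" using Suc.prems fin finite_subset by blast
  have "box_sum (\<lambda>_. 1) (Suc k) (tail e) S =
      (\<Sum>I\<in>Pow S. \<Sum>J\<in>Pow I. ?w I * (weight J ^ k * eig_coeff e J * eig J I))"
    unfolding box_sum_Suc[OF Suc.prems]
    using Suc by (intro sum.cong refl) (simp add: sum_distrib_left)
  also have "\<dots> = (\<Sum>J\<in>Pow S. \<Sum>K\<in>Pow (S - J).
      ?w (J \<union> K) * (weight J ^ k * eig_coeff e J * eig J (J \<union> K)))"
    by (rule sum_Pow_Pow[OF finS])
  also have "\<dots> = (\<Sum>J\<in>Pow S. weight J ^ k * eig_coeff e J *
      (\<Sum>K\<in>Pow (S - J). ?w (J \<union> K) * eig J (J \<union> K)))"
    by (simp add: sum_distrib_left mult_ac)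
  also have "\<dots> = (\<Sum>J\<in>Pow S. weight J ^ Suc k * eig_coeff e J * eig J S)"
    using Suc.prems by (intro sum.cong refl, subst weight_eig) (auto simp: mult_ac)
  finally show ?case .
qed

text \<open>The inner \<open>k\<close> columns contribute \<open>weight J ^ k\<close>. The outermost
  one contributes one more \<open>weight J\<close>, and its extra factor replaces
  \<open>eig J T\<close> by the product with numerators \<open>1 - a * x j\<close>.\<close>

lemma box_sum_qpoch:
  "box_sum (qpoch a (inverse q)) (Suc k) (tail e) T =
    (\<Sum>J\<in>Pow T. weight J ^ Suc k * eig_coeff e J * qpoch a (inverse q) (card J) *
      (cross q x J (T - J) * (\<Prod>j\<in>T - J. (1 - a * x j) / (1 - x j * q ^ card J))))"
proof -
  let ?w = "\<lambda>I. qpoch a (inverse q) (card I) * weight I * cross q x I (T - I)"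
  have "box_sum (qpoch a (inverse q)) (Suc k) (tail e) T =
      (\<Sum>I\<in>Pow T. \<Sum>J\<in>Pow I. ?w I * (weight J ^ k * eig_coeff e J * eig J I))"
    unfolding box_sum_Suc[OF order.refl]
    by (intro sum.cong refl) (simp add: sum_distrib_left box_sum_expansion)
  also have "\<dots> = (\<Sum>J\<in>Pow T. \<Sum>K\<in>Pow (T - J).
      ?w (J \<union> K) * (weight J ^ k * eig_coeff e J * eig J (J \<union> K)))"
    by (rule sum_Pow_Pow[OF fin])
  also have "\<dots> = (\<Sum>J\<in>Pow T. weight J ^ k * eig_coeff e J *
      (\<Sum>K\<in>Pow (T - J). ?w (J \<union> K) * eig J (J \<union> K)))"
    by (simp add: sum_distrib_left mult_ac)
  also have "\<dots> = (\<Sum>J\<in>Pow T. weight J ^ Suc k * eig_coeff e J * qpoch a (inverse q) (card J) *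
      (cross q x J (T - J) * (\<Prod>j\<in>T - J. (1 - a * x j) / (1 - x j * q ^ card J))))"
    by (intro sum.cong refl, subst sum_qpoch_eig) (auto simp: mult_ac)
  finally show ?thesis .
qed

lemma tail_eq_qpoch:
  assumes "m \<le> card T"
  shows "tail (a * inverse q ^ (card T - 1)) m = qpoch a (inverse q) (card T - m)"
  unfolding tail_def qpoch_def
proof (rule prod.reindex_bij_witness[where i = "\<lambda>j. card T - 1 - j" and j = "\<lambda>j. card T - 1 - j"])
  fix j assume "j \<in> {m..<card T}"
  then have "card T - 1 = (card T - 1 - j) + j" by auto
  then have "a * inverse q ^ (card T - 1) * q ^ j =
      a * inverse q ^ (card T - 1 - j) * (inverse q ^ j * q ^ j)"
    by (metis power_add mult.assoc)
  also have "inverse q ^ j * q ^ j = 1" using q0 by (simp flip: power_mult_distrib)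
  finally show "1 - a * inverse q ^ (card T - 1 - j) = 1 - a * inverse q ^ (card T - 1) * q ^ j"
    by (simp only: mult_1_right)
qed auto

end

theorem theorem19:
  fixes n k :: nat
    and a q :: "'a::field_char_0"
    and x :: "nat \<Rightarrow> 'a"
  assumes "n \<ge> 1" and "k \<ge> 1"
    and "q \<noteq> 0" and "\<forall>r\<in>{1..n}. q ^ r \<noteq> 1"
    and "inj_on x {1..n}"
    and "\<forall>i\<in>{1..n}. x i \<noteq> 0"
    and "\<forall>i\<in>{1..n}. \<forall>r<n. x i * q ^ r \<noteq> 1"
  shows
    "(\<Sum>lam\<in>partitions_in_box k n.
        q ^ part_n lam *
        qpoch a (inverse q) (part_length lam) *
        qpoch a (inverse q) (n - part_mult n lam k) *
        hall_littlewood_P n lam x q) =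
     (\<Sum>I\<in>Pow {1..n}.
        q ^ (k * (card I choose 2)) *
        qpoch a (inverse q) (card I) *
        qpoch a (inverse q) (n - card I) *
        (\<Prod>i\<in>I. x i ^ k) *
        (\<Prod>i\<in>I. (1 - a * inverse (x i) * q powi (1 - int n)) /
                  (1 - inverse (x i) * q powi (1 - int (card I)))) *
        (\<Prod>j\<in>{1..n} - I. (1 - a * x j) / (1 - x j * q ^ card I)) *
        (\<Prod>(i, j)\<in>I \<times> ({1..n} - I). (x i - q * x j) / (x i - x j)))"
    (is "?lhs = ?rhs")
proof -
  let ?T = "{1..n}"
  have "q \<noteq> 1" using assms(1,4) by (auto dest: bspec[of _ _ 1])
  interpret hl_generic_point q x ?T
    by unfold_locales (use assms \<open>q \<noteq> 1\<close> in auto)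
  define e where "e = a * inverse q ^ (n - 1)"
  have tail: "tail e m = qpoch a (inverse q) (n - m)" if "m \<le> n" for m
    using tail_eq_qpoch[of m a] that by (simp add: e_def)
  have powi: "q powi (1 - int m) = inverse q ^ (m - 1)" if "m \<ge> 1" for m
  proof -
    have "1 - int m = - int (m - 1)" using that by simp
    then show ?thesis by (simp only: power_int_minus power_int_of_nat power_inverse)
  qed
  \<comment> \<open>A first column must exist to carry the factor at the length.\<close>
  obtain k' where k': "k = Suc k'" using assms(2) by (cases k) auto
  have "?lhs = box_sum (qpoch a (inverse q)) k (tail e) ?T"
    unfolding box_sum_def
  proof (intro sum.cong)
    have c: "card ?T = n" by simp
    fix lam assume "lam \<in> partitions_in_box k (card ?T)"
    then have lam: "lam \<in> partitions_in_box k n" unfolding c .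
    have "part_mult n lam k \<le> card ?T"
      unfolding part_mult_def by (rule card_mono) auto
    then have m: "part_mult n lam k \<le> n" unfolding c .
    show "q ^ part_n lam * qpoch a (inverse q) (part_length lam) *
        qpoch a (inverse q) (n - part_mult n lam k) * hall_littlewood_P n lam x q =
      q ^ part_n lam * qpoch a (inverse q) (part_length lam) *
        tail e (part_mult (card ?T) lam k) * hl_poly k q x ?T lam"
      by (simp only: c tail[OF m] hall_littlewood_P_eq_hl_poly[OF lam])
  qed simp
  also have "\<dots> = ?rhs"
    unfolding k' box_sum_qpoch unfolding k'[symmetric]
  proof (rule sum.cong[OF refl])
    fix I assume "I \<in> Pow ?T"
    then have I: "I \<subseteq> ?T" "finite I" "card I \<le> n"
      using finite_subset card_mono[of ?T I] by auto
    \<comment> \<open>Numerator and denominator are both multiplied by \<open>inverse (x i)\<close>.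
      Since \<open>I\<close> contains \<open>i\<close>, the subtraction \<open>card I - 1\<close> is
      exact.\<close>
    have 1: "(x i - e) / (x i - inverse q ^ (card I - 1)) =
        (1 - a * inverse (x i) * q powi (1 - int n)) / (1 - inverse (x i) * q powi (1 - int (card I)))"
      if "i \<in> I" for i
    proof -
      have "x i \<noteq> 0" using that I assms(6) by auto
      have "card I \<ge> 1" using that I by (auto simp: Suc_le_eq card_gt_0_iff)
      have "1 - a * inverse (x i) * inverse q ^ (n - 1) = inverse (x i) * (x i - e)"
        "1 - inverse (x i) * inverse q ^ (card I - 1) = inverse (x i) * (x i - inverse q ^ (card I - 1))"
        using \<open>x i \<noteq> 0\<close> by (simp_all add: e_def algebra_simps)
      then show ?thesis
        using \<open>x i \<noteq> 0\<close> unfolding powi[OF assms(1)] powi[OF \<open>card I \<ge> 1\<close>] by simp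
    qed
    have 2: "weight I ^ k = q ^ (k * (card I choose 2)) * (\<Prod>i\<in>I. x i ^ k)"
      by (simp add: weight_def power_mult_distrib prod_power_distrib mult.commute flip: power_mult)
    have 3: "eig_coeff e I = qpoch a (inverse q) (n - card I) *
        (\<Prod>i\<in>I. (1 - a * inverse (x i) * q powi (1 - int n)) /
          (1 - inverse (x i) * q powi (1 - int (card I))))"
      unfolding eig_coeff_def tail[OF I(3)] using 1 by simp
    show "weight I ^ k * eig_coeff e I * qpoch a (inverse q) (card I) *
        (cross q x I (?T - I) * (\<Prod>j\<in>?T - I. (1 - a * x j) / (1 - x j * q ^ card I))) =
      q ^ (k * (card I choose 2)) * qpoch a (inverse q) (card I) * qpoch a (inverse q) (n - card I) *
        (\<Prod>i\<in>I. x i ^ k) *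
        (\<Prod>i\<in>I. (1 - a * inverse (x i) * q powi (1 - int n)) /
          (1 - inverse (x i) * q powi (1 - int (card I)))) *
        (\<Prod>j\<in>?T - I. (1 - a * x j) / (1 - x j * q ^ card I)) *
        (\<Prod>(i, j)\<in>I \<times> (?T - I). (x i - q * x j) / (x i - x j))"
      unfolding 2 3 cross_def prod.cartesian_product by (simp only: mult_ac)
  qed
  finally show ?thesis .
qed

end
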